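(* Let $G$ be a graph on $n$ vertices with minimum degree $\delta$ and maximum degree $\Delta<n-1$, and let $t$ be a positive integer such that $G$ is a $t$-expander. Then $$\mathrm{box}(G)\ge\frac{n(n-\Delta-1)}{2(t-1)\left[(n-\Delta-1)+(n-\delta-1)\right]}.$$
   Context: A graph $G=(V,E)$ is a $t$-expander if for every $S\subseteq V$ with $|S|=t$, $|\{v\in V\setminus S : uv\notin E\text{ for all }u\in S\}|<t$; equivalently the complement of $G$ contains no $K_{t,t}$ subgraph. The boxicity $\mathrm{box}(G)$ is the minimum $k$ such that there are interval graphs $I_1,\dots,I_k$ on $V$ with $E(G)=E(I_1)\cap\cdots\cap E(I_k)$. *)

theory Defs
  imports Complex_Main "Graph_Theory.Pair_Digraph"
begin

text \<open>
  A finite simple undirected graph is a \<^locale>\<open>pair_graph\<close>: a finite, loop-free digraph with a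
  symmetric set of ordered arcs, where the edge $uv$ is the pair of arcs $(u,v)$ and $(v,u)$.
  Hence the degree of a vertex is its \<^const>\<open>out_degree\<close>.
\<close>

definition min_degree :: "'a pair_pre_digraph \<Rightarrow> nat" where
  "min_degree G = Min (out_degree (with_proj G) ` pverts G)"

definition max_degree :: "'a pair_pre_digraph \<Rightarrow> nat" where
  "max_degree G = Max (out_degree (with_proj G) ` pverts G)"

definition expander :: "nat \<Rightarrow> 'a pair_pre_digraph \<Rightarrow> bool" where
  "expander t G \<longleftrightarrow>
     (\<forall>S. S \<subseteq> pverts G \<and> card S = t \<longrightarrow>
        card {v \<in> pverts G - S. \<forall>u\<in>S. (u, v) \<notin> parcs G} < t)"

definition interval_graph :: "'a pair_pre_digraph \<Rightarrow> bool" where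
  "interval_graph I \<longleftrightarrow> pair_graph I \<and>
     (\<exists>l r :: 'a \<Rightarrow> real.
        (\<forall>v \<in> pverts I. l v \<le> r v) \<and>
        (\<forall>u \<in> pverts I. \<forall>v \<in> pverts I. u \<noteq> v \<longrightarrow>
           ((u, v) \<in> parcs I \<longleftrightarrow> {l u..r u} \<inter> {l v..r v} \<noteq> {})))"

text \<open>
  The intersection of edge sets is taken inside the edge set of the complete graph, so that for
  \<open>k = 0\<close> the empty intersection is complete, and complete graphs have boxicity 0.
\<close>

definition interval_rep :: "'a pair_pre_digraph \<Rightarrow> nat \<Rightarrow> bool" where
  "interval_rep G k \<longleftrightarrow>
     (\<exists>I :: nat \<Rightarrow> 'a pair_pre_digraph.
        (\<forall>i<k. interval_graph (I i) \<and> pverts (I i) = pverts G) \<and>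
        parcs G = {(u, v). u \<in> pverts G \<and> v \<in> pverts G \<and> u \<noteq> v} \<inter> (\<Inter>i<k. parcs (I i)))"

definition boxicity :: "'a pair_pre_digraph \<Rightarrow> nat" where
  "boxicity G = (LEAST k. interval_rep G k)"

text \<open>
  Every graph has a representation, so the minimum above exists: for each vertex \<open>w\<close>, take the
  interval graph whose only non-edges join \<open>w\<close> to its non-neighbours.
\<close>

lemma interval_rep_exists:
  assumes "pair_graph G"
  shows "interval_rep G (card (pverts G))"
proof -
  interpret pair_graph G by fact
  have symG: "(u, v) \<in> parcs G \<longleftrightarrow> (v, u) \<in> parcs G" for u v
    using pair_sym_arcs symD[of "parcs G" u v] symD[of "parcs G" v u]
    by (simp only: symmetric_def with_proj_simps) blast
  have noloop: "(u, u) \<notin> parcs G" for u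
    using pair_no_loops by force
  define H where "H w = \<lparr>pverts = pverts G,
     parcs = {(u, v). u \<in> pverts G \<and> v \<in> pverts G \<and> u \<noteq> v \<and>
       (u = w \<longrightarrow> (w, v) \<in> parcs G) \<and> (v = w \<longrightarrow> (w, u) \<in> parcs G)}\<rparr>" for w
  have pg: "pair_graph (H w)" for w
  proof unfold_locales
    show "finite (parcs (H w))"
      by (rule finite_subset[of _ "pverts G \<times> pverts G"])
        (auto simp: H_def pair_finite_verts)
  qed (auto simp: H_def pair_finite_verts symmetric_def sym_def)
  have ig: "interval_graph (H w)" for w
  proof -
    let ?l = "\<lambda>v. if v = w \<or> (w, v) \<in> parcs G then 0 else 1 :: real"
    let ?r = "\<lambda>v. if v = w then 0 else 1 :: real"
    show ?thesis
      unfolding interval_graph_def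
      by (intro conjI pg exI[of _ ?l] exI[of _ ?r]) (auto simp: H_def noloop)
  qed
  obtain f where f: "bij_betw f {..<card (pverts G)} (pverts G)"
    using ex_bij_betw_nat_finite[OF pair_finite_verts] by (auto simp: atLeast0LessThan)
  have "(\<Inter>i<card (pverts G). parcs (H (f i))) = (\<Inter>w\<in>pverts G. parcs (H w))"
    using bij_betw_imp_surj_on[OF f] by (metis image_image)
  moreover have "parcs G =
      {(u, v). u \<in> pverts G \<and> v \<in> pverts G \<and> u \<noteq> v} \<inter> (\<Inter>w\<in>pverts G. parcs (H w))"
  proof (intro set_eqI iffI)
    fix e assume e: "e \<in> parcs G"
    obtain u v where uv: "e = (u, v)" by (cases e)
    have "u \<in> pverts G" "v \<in> pverts G" "u \<noteq> v" "(v, u) \<in> parcs G"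
      using e uv in_arcsD1 in_arcsD2 noloop symG[of u v] by blast+
    then show "e \<in> {(u, v). u \<in> pverts G \<and> v \<in> pverts G \<and> u \<noteq> v} \<inter> (\<Inter>w\<in>pverts G. parcs (H w))"
      using e uv by (auto simp: H_def)
  next
    fix e assume e: "e \<in> {(u, v). u \<in> pverts G \<and> v \<in> pverts G \<and> u \<noteq> v} \<inter> (\<Inter>w\<in>pverts G. parcs (H w))"
    then obtain u v where uv: "e = (u, v)" "u \<in> pverts G" by auto
    then have "(u, v) \<in> parcs (H u)" using e by simp
    then show "e \<in> parcs G" using uv by (simp add: H_def)
  qed
  moreover have "interval_graph (H (f i)) \<and> pverts (H (f i)) = pverts G" for i
    using ig by (simp add: H_def)
  ultimately show ?thesis
    unfolding interval_rep_def by (intro exI[of _ "\<lambda>i. H (f i)"]) simp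
qed

end

theory Submission
  imports Defs
begin

text \<open>
  In an interval representation of a supergraph of \<open>G\<close>, every non-edge consists of an interval \<open>u\<close>
  entirely to the left of an interval \<open>v\<close>. Let \<open>A\<close> be the \<open>t - 1\<close> intervals with the leftmost right
  endpoints and \<open>m\<close> the next one. Either \<open>u \<in> A\<close>, or \<open>v\<close> lies to the right of \<open>m\<close>, hence of all \<open>t\<close>
  intervals in \<open>A \<union> {m}\<close>, and by expansion there are at most \<open>t - 1\<close> such \<open>v\<close>. So \<open>2(t - 1)\<close> vertices
  cover all non-edges of one interval graph, and a set \<open>T\<close> of \<open>s \<le> 2(t - 1) box(G)\<close> vertices covers
  all non-edges of \<open>G\<close>. Counting the non-edges between \<open>T\<close> and its complement gives
  \<open>(n - s)(n - \<Delta> - 1) \<le> s(n - \<delta> - 1)\<close>.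
\<close>

lemma ex_smallest_subset:
  fixes f :: "'a \<Rightarrow> 'b::linorder"
  assumes "finite V" "k \<le> card V"
  shows "\<exists>A\<subseteq>V. card A = k \<and> (\<forall>x\<in>A. \<forall>y\<in>V - A. f x \<le> f y)"
  using assms(2)
proof (induction k)
  case 0
  show ?case by (intro exI[of _ "{}"]) simp
next
  case (Suc k)
  then obtain A where A: "A \<subseteq> V" "card A = k" "\<forall>x\<in>A. \<forall>y\<in>V - A. f x \<le> f y"
    by auto
  have fin: "finite A" using A(1) assms(1) finite_subset by blast
  have "V - A \<noteq> {}" using A Suc.prems by auto
  then obtain m where m: "m \<in> V - A" "\<forall>y\<in>V - A. f m \<le> f y"
    using arg_min_if_finite(1)[of "V - A" f] arg_min_least[of "V - A" _ f] assms(1)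
    by (metis finite_Diff)
  show ?case
    using A m fin by (intro exI[of _ "insert m A"]) auto
qed

lemma interval_graph_nonedge_cover:
  fixes I :: "'a pair_pre_digraph"
  assumes "interval_graph I" "expander t I" "t > 0"
  shows "\<exists>T\<subseteq>pverts I. card T \<le> 2 * (t - 1) \<and>
    (\<forall>u\<in>pverts I - T. \<forall>v\<in>pverts I - T. u \<noteq> v \<longrightarrow> (u, v) \<in> parcs I)"
proof -
  let ?V = "pverts I"
  from assms(1) have pg: "pair_graph I" unfolding interval_graph_def by blast
  interpret pair_graph I by (rule pg)
  have fin: "finite ?V" by (rule pair_finite_verts)
  obtain l r :: "'a \<Rightarrow> real" where lr: "\<And>v. v \<in> ?V \<Longrightarrow> l v \<le> r v"
    and arc: "\<And>u v. u \<in> ?V \<Longrightarrow> v \<in> ?V \<Longrightarrow> u \<noteq> v \<Longrightarrow>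
      (u, v) \<in> parcs I \<longleftrightarrow> {l u..r u} \<inter> {l v..r v} \<noteq> {}"
    using assms(1) unfolding interval_graph_def by blast
  show ?thesis
  \<comment> \<open>Expansion needs a set of \<open>t\<close> vertices. If there is none,
    \<open>?V\<close> itself has at most \<open>t - 1\<close> vertices and serves as the
    cover.\<close>
  proof (cases "card ?V < t")
    case True
    then show ?thesis by (intro exI[of _ ?V]) auto
  next
    case False
    then obtain A where A: "A \<subseteq> ?V" "card A = t - 1" "\<forall>x\<in>A. \<forall>y\<in>?V - A. r x \<le> r y"
      using ex_smallest_subset[OF fin, of "t - 1" r] by force
    have finA: "finite A" using A(1) fin finite_subset by blast
    have "?V - A \<noteq> {}" using A False assms(3) by auto
    then obtain m where m: "m \<in> ?V - A" "\<forall>y\<in>?V - A. r m \<le> r y"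
      using arg_min_if_finite(1)[of "?V - A" r] arg_min_least[of "?V - A" _ r] fin
      by (metis finite_Diff)
    define B where "B = {v \<in> ?V. r m < l v}"
    let ?S = "insert m A"
    have S: "?S \<subseteq> ?V" "card ?S = t" using A m finA assms(3) by auto
    have Sr: "r x \<le> r m" if "x \<in> ?S" for x using that A(3) m(1) by auto
    have "B \<subseteq> {v \<in> ?V - ?S. \<forall>u\<in>?S. (u, v) \<notin> parcs I}"
    proof
      fix v assume "v \<in> B"
      then have v: "v \<in> ?V" "r m < l v" by (auto simp: B_def)
      have vS: "v \<notin> ?S" using Sr[of v] lr[OF v(1)] v(2) by force
      have "(u, v) \<notin> parcs I" if "u \<in> ?S" for u
      proof -
        have "u \<in> ?V" "u \<noteq> v" "r u < l v" using that S(1) vS Sr[OF that] v(2) by auto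
        then show ?thesis using arc[of u v] v(1) by auto
      qed
      then show "v \<in> {v \<in> ?V - ?S. \<forall>u\<in>?S. (u, v) \<notin> parcs I}" using v(1) vS by blast
    qed
    then have "card B \<le> card {v \<in> ?V - ?S. \<forall>u\<in>?S. (u, v) \<notin> parcs I}"
      using fin by (intro card_mono) auto
    also have "\<dots> < t" using assms(2) S unfolding expander_def by blast
    finally have cB: "card B \<le> t - 1" by simp
    \<comment> \<open>Outside \<open>A\<close> no right endpoint is below \<open>r m\<close>, and
      outside \<open>B\<close> no left endpoint is above it, so
      \<open>l v \<le> r m \<le> r u\<close>.\<close>
    have left: "\<not> r u < l v" if "u \<in> ?V - (A \<union> B)" "v \<in> ?V - (A \<union> B)" for u v
      using that m(2) unfolding B_def by force
    have "(u, v) \<in> parcs I" if "u \<in> ?V - (A \<union> B)" "v \<in> ?V - (A \<union> B)" "u \<noteq> v" for u v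
    proof -
      \<comment> \<open>Two intervals, neither strictly left of the other, share the larger of their
        left endpoints.\<close>
      have "max (l u) (l v) \<in> {l u..r u} \<inter> {l v..r v}"
        using left[of u v] left[of v u] that lr[of u] lr[of v] by auto
      then show ?thesis using arc[of u v] that by blast
    qed
    moreover have "card (A \<union> B) \<le> 2 * (t - 1)"
      using card_Un_le[of A B] A(2) cB by linarith
    ultimately show ?thesis
      using A(1) by (intro exI[of _ "A \<union> B"]) (auto simp: B_def)
  qed
qed

text \<open>Adding edges only removes common non-neighbours. This passes expansion from
  \<open>G\<close> to every interval graph of a representation.\<close>

lemma expander_mono:
  assumes "expander t G" "pverts H = pverts G" "parcs G \<subseteq> parcs H" "finite (pverts G)"
  shows "expander t H"
  unfolding expander_def
proof (intro allI impI)
  fix S assume S: "S \<subseteq> pverts H \<and> card S = t"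
  have "card {v \<in> pverts H - S. \<forall>u\<in>S. (u, v) \<notin> parcs H}
      \<le> card {v \<in> pverts G - S. \<forall>u\<in>S. (u, v) \<notin> parcs G}"
    using assms by (intro card_mono) auto
  also have "\<dots> < t" using assms S unfolding expander_def by auto
  finally show "card {v \<in> pverts H - S. \<forall>u\<in>S. (u, v) \<notin> parcs H} < t" .
qed

text \<open>The union of the \<open>k\<close> individual covers works: a pair outside it is an edge
  of every \<open>I i\<close>, hence of their intersection \<open>G\<close>.\<close>

lemma interval_rep_nonedge_cover:
  assumes "interval_rep G k" "expander t G" "finite (pverts G)" "t > 0"
  shows "\<exists>T\<subseteq>pverts G. card T \<le> k * (2 * (t - 1)) \<and>
    (\<forall>u\<in>pverts G - T. \<forall>v\<in>pverts G - T. u \<noteq> v \<longrightarrow> (u, v) \<in> parcs G)"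
proof -
  obtain I where I: "\<And>i. i < k \<Longrightarrow> interval_graph (I i)" "\<And>i. i < k \<Longrightarrow> pverts (I i) = pverts G"
    and arcs: "parcs G = {(u, v). u \<in> pverts G \<and> v \<in> pverts G \<and> u \<noteq> v} \<inter> (\<Inter>i<k. parcs (I i))"
    using assms(1) unfolding interval_rep_def by blast
  have "\<exists>T\<subseteq>pverts G. card T \<le> 2 * (t - 1) \<and>
    (\<forall>u\<in>pverts G - T. \<forall>v\<in>pverts G - T. u \<noteq> v \<longrightarrow> (u, v) \<in> parcs (I i))" if "i < k" for i
  proof -
    have "parcs G \<subseteq> parcs (I i)" using arcs that by blast
    then have "expander t (I i)"
      using expander_mono[OF assms(2) I(2)[OF that]] assms(3) by blast
    from interval_graph_nonedge_cover[OF I(1)[OF that] this assms(4)] show ?thesis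
      by (simp only: I(2)[OF that])
  qed
  then obtain T where T: "\<And>i. i < k \<Longrightarrow> T i \<subseteq> pverts G" "\<And>i. i < k \<Longrightarrow> card (T i) \<le> 2 * (t - 1)"
    "\<And>i u v. i < k \<Longrightarrow> u \<in> pverts G - T i \<Longrightarrow> v \<in> pverts G - T i \<Longrightarrow> u \<noteq> v \<Longrightarrow> (u, v) \<in> parcs (I i)"
    by metis
  have "card (\<Union>i<k. T i) \<le> (\<Sum>i<k. card (T i))" by (rule card_UN_le) simp
  also have "\<dots> \<le> k * (2 * (t - 1))"
    using sum_bounded_above[of "{..<k}" "\<lambda>i. card (T i)" "2 * (t - 1)"] T(2) by simp
  finally have "card (\<Union>i<k. T i) \<le> k * (2 * (t - 1))" .
  moreover have "(u, v) \<in> parcs G"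
    if "u \<in> pverts G - (\<Union>i<k. T i)" "v \<in> pverts G - (\<Union>i<k. T i)" "u \<noteq> v" for u v
    unfolding arcs using that T(3) by blast
  ultimately show ?thesis
    using T(1) by (intro exI[of _ "\<Union>i<k. T i"]) blast
qed

text \<open>This turns the degree bounds of \<open>G\<close> into degree bounds in its
  complement.\<close>

lemma (in pair_graph) card_non_neighbours:
  assumes "v \<in> pverts G"
  shows "card {w \<in> pverts G. w \<noteq> v \<and> (v, w) \<notin> parcs G} + out_degree (with_proj G) v + 1
    = card (pverts G)"
proof -
  let ?N = "{w. (v, w) \<in> parcs G}"
  have N: "?N \<subseteq> pverts G" "v \<notin> ?N"
    using in_arcsD2 pair_no_loops by force+
  have finN: "finite ?N" using N(1) pair_finite_verts finite_subset by blast
  \<comment> \<open>\<open>out_degree\<close> counts arcs; pairing with the fixed tail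
    \<open>v\<close> identifies them with neighbours.\<close>
  have "out_arcs (with_proj G) v = Pair v ` ?N"
    by (auto simp: out_arcs_def)
  then have "out_degree (with_proj G) v = card ?N"
    unfolding out_degree_def by (simp add: card_image inj_on_def)
  moreover have "{w \<in> pverts G. w \<noteq> v \<and> (v, w) \<notin> parcs G} = pverts G - insert v ?N" by auto
  moreover have "card (pverts G - insert v ?N) = card (pverts G) - card (insert v ?N)"
    using N assms finN by (intro card_Diff_subset) auto
  moreover have "card (insert v ?N) \<le> card (pverts G)"
    using N assms pair_finite_verts by (intro card_mono) auto
  ultimately show ?thesis using N(2) finN by simp
qed

theorem theorem11:
  fixes G :: "'a pair_pre_digraph" and n t \<delta> \<Delta> :: nat
  assumes "pair_graph G"
    and "n = card (pverts G)"
    and "\<delta> = min_degree G"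
    and "\<Delta> = max_degree G"
    and "\<Delta> < n - 1"
    and "t > 0"
    and "expander t G"
  shows "real (boxicity G) \<ge>
    real n * (real n - real \<Delta> - 1) /
      (2 * (real t - 1) * ((real n - real \<Delta> - 1) + (real n - real \<delta> - 1)))"
proof -
  interpret pair_graph G by fact
  let ?V = "pverts G"
  have fin: "finite ?V" by (rule pair_finite_verts)
  define k where "k = boxicity G"
  have "interval_rep G k"
    unfolding k_def boxicity_def using interval_rep_exists[OF assms(1)] by (rule LeastI)
  from interval_rep_nonedge_cover[OF this assms(7) fin assms(6)]
  obtain T where T: "T \<subseteq> ?V" "card T \<le> k * (2 * (t - 1))"
    and clique: "\<And>u v. u \<in> ?V - T \<Longrightarrow> v \<in> ?V - T \<Longrightarrow> u \<noteq> v \<Longrightarrow> (u, v) \<in> parcs G"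
    by blast
  have finT: "finite T" using T(1) fin finite_subset by blast
  define N where "N v = {w \<in> ?V. w \<noteq> v \<and> (v, w) \<notin> parcs G}" for v
  have N_sym: "w \<in> N v \<longleftrightarrow> v \<in> N w" if "v \<in> ?V" "w \<in> ?V" for v w
    using that pair_sym_arcs symD[of "parcs G" v w] symD[of "parcs G" w v]
    unfolding N_def symmetric_def by auto
  \<comment> \<open>Lower and upper bounds for the degrees \<open>card (N v)\<close> in the
    complement.\<close>
  define a b where "a = n - \<Delta> - 1" and "b = n - \<delta> - 1"
  have deg: "a \<le> card (N v)" "card (N v) \<le> b" if "v \<in> ?V" for v
  proof -
    let ?D = "out_degree (with_proj G) ` ?V"
    have "finite ?D" "out_degree (with_proj G) v \<in> ?D" using fin that by auto
    then have "\<delta> \<le> out_degree (with_proj G) v" "out_degree (with_proj G) v \<le> \<Delta>"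
      unfolding assms(3,4) min_degree_def max_degree_def by auto
    with card_non_neighbours[OF that] show "a \<le> card (N v)" "card (N v) \<le> b"
      unfolding a_def b_def N_def assms(2) by linarith+
  qed
  have "?V \<noteq> {}" using assms(2,5) by auto
  then have ab: "a \<le> b" using deg by (meson all_not_in_conv le_trans)
  have cVT: "card (?V - T) = n - card T" "card T \<le> n"
    using T(1) finT fin assms(2) by (auto simp: card_Diff_subset card_mono)
  \<comment> \<open>Double counting of the non-adjacent pairs between \<open>?V - T\<close> and
    \<open>T\<close>: each vertex outside \<open>T\<close> is in at least \<open>a\<close> of them,
    each vertex of \<open>T\<close> in at most \<open>b\<close>.\<close>
  have "(n - card T) * a \<le> (\<Sum>u\<in>?V - T. card (N u))"
    using sum_bounded_below[of "?V - T" a "\<lambda>u. card (N u)"] deg(1) cVT by simp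
  also have "\<dots> = (\<Sum>u\<in>?V - T. card {w \<in> T. w \<in> N u})"
  proof (rule sum.cong)
    fix u assume "u \<in> ?V - T"
    \<comment> \<open>By \<open>clique\<close>, a vertex outside \<open>T\<close> has all its
      non-neighbours in \<open>T\<close>.\<close>
    then have "N u = {w \<in> T. w \<in> N u}"
      using clique[of u] unfolding N_def by blast
    then show "card (N u) = card {w \<in> T. w \<in> N u}" by simp
  qed simp
  also have "\<dots> = (\<Sum>w\<in>T. card {u \<in> ?V - T. w \<in> N u})"
    using sum.swap_restrict[of "?V - T" T "\<lambda>_ _. 1::nat" "\<lambda>u w. w \<in> N u"] fin finT by simp
  also have "\<dots> \<le> (\<Sum>w\<in>T. b)"
  proof (rule sum_mono)
    fix w assume w: "w \<in> T"
    then have "{u \<in> ?V - T. w \<in> N u} \<subseteq> N w" using N_sym[of _ w] T(1) by blast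
    then have "card {u \<in> ?V - T. w \<in> N u} \<le> card (N w)"
      using fin by (intro card_mono) (auto simp: N_def)
    then show "card {u \<in> ?V - T. w \<in> N u} \<le> b"
      using deg(2)[of w] w T(1) by fastforce
  qed
  finally have "(n - card T) * a \<le> card T * b" by simp
  \<comment> \<open>Add \<open>card T * a\<close> to both sides; the natural difference is exact
    because \<open>card T \<le> n\<close>.\<close>
  then have "n * a \<le> card T * (a + b)"
    using cVT(2) by (simp add: algebra_simps)
  also have "\<dots> \<le> k * (2 * (t - 1)) * (a + b)" using T(2) by (rule mult_le_mono1)
  finally have "real (n * a) \<le> real (k * (2 * (t - 1)) * (a + b))"
    by (rule of_nat_mono)
  then have main: "real n * real a \<le> real k * (2 * real (t - 1) * (real a + real b))"
    by (simp only: of_nat_mult of_nat_add of_nat_numeral mult.assoc)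
  \<comment> \<open>No subtraction is truncated: \<Delta> \<open>< n - 1\<close> gives
    \<open>a > 0\<close>, and then \<open>a \<le> b\<close> gives \<open>b > 0\<close>.\<close>
  have "n = \<Delta> + 1 + a" "n = \<delta> + 1 + b" "t = 1 + (t - 1)"
    using assms(5,6) ab unfolding a_def b_def by linarith+
  then have coeffs: "real n - real \<Delta> - 1 = real a" "real n - real \<delta> - 1 = real b"
    "real t - 1 = real (t - 1)"
    by linarith+
  show ?thesis
  \<comment> \<open>For \<open>t = 1\<close> the denominator is zero, and division by zero yields 0,
    so the bound is trivial.\<close>
  proof (cases "t = 1")
    case True
    then show ?thesis by simp
  next
    case False
    then have "2 * real (t - 1) * (real a + real b) > 0"
      using assms(5,6) unfolding a_def by simp
    from pos_divide_le_eq[OF this] main show ?thesis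
      unfolding coeffs k_def[symmetric] by blast
  qed
qed

end
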